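(* Let $n\ge 2$ and let $\mathcal{T}$ be a uniform random rooted tree on $\{1,\ldots,n-1\}$ (uniformly distributed over the set of all rooted labeled trees with vertex set $\{1,\ldots,n-1\}$, with edges oriented away from the root). From this tree, build a forest $\mathcal{F}$ on $\{1,\ldots,n\}$ according to the following procedure: (1) Remove all decreasing edges from $\mathcal{T}$, that is, all edges $\vec{uv}$ (pointing away from the root) such that $u>v$. (2) Add a vertex labeled $n$ and connect it to a uniformly chosen vertex $w$ of $\mathcal{T}$ (by the directed edge $\vec{wn}$; $w$ is uniform on $\{1,\ldots,n-1\}$ and independent of $\mathcal{T}$). (3) Relabel the vertices according to a uniform permutation of $\{1,\ldots,n\}$ (independent of the rest). Then the resulting forest $\mathcal{F}$ has the law of the Moran forest $\mathscr{F}_n$.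
   Context: A rooted forest on $\{1,\ldots,n\}$ is a disjoint union of rooted trees, viewed as a directed graph with edges pointing away from the roots (each vertex has at most one incoming edge; vertices with no incoming edge are the roots). Moran forest: for fixed $n\ge 2$, consider the Markov chain on directed graphs on $\{1,\ldots,n\}$ whose transitions are: at each time-step, choose an ordered pair of distinct vertices $(u,v)$ uniformly at random; disconnect $v$ from all of its neighbors (remove all edges incident to $v$), then add the edge $\vec{uv}$. This chain has a unique stationary distribution, whose support is the set of non-empty rooted forests (those with at least one edge) on $\{1,\ldots,n\}$. The Moran forest $\mathscr{F}_n$ is a random forest having this stationary distribution. *)

theory Defs
  imports "HOL-Probability.Probability" "HOL-Combinatorics.Permutations"
begin

text \<open>Directed graphs are represented by their edge sets; the vertex set is kept separately.\<close>

definition digraphs :: "'a set \<Rightarrow> 'a rel set" where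
  "digraphs V = {E. E \<subseteq> V \<times> V \<and> irrefl E}"

definition moran_step :: "nat \<Rightarrow> nat rel \<Rightarrow> nat rel pmf" where
  "moran_step n E =
    do {
      (u, v) \<leftarrow> pmf_of_set {(u, v). u \<in> {1..n} \<and> v \<in> {1..n} \<and> u \<noteq> v};
      return_pmf (insert (u, v) {(a, b) \<in> E. a \<noteq> v \<and> b \<noteq> v})
    }"

definition moran_stationary :: "nat \<Rightarrow> nat rel pmf \<Rightarrow> bool" where
  "moran_stationary n p \<longleftrightarrow>
    set_pmf p \<subseteq> digraphs {1..n} \<and> bind_pmf p (moran_step n) = p"

text \<open>For \<open>n \<ge> 2\<close> the chain has exactly one stationary distribution; for \<open>n < 2\<close> there is
  no pair of distinct vertices and the definition is meaningless.\<close>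

definition moran_forest :: "nat \<Rightarrow> nat rel pmf" where
  "moran_forest n = (THE p. moran_stationary n p)"

text \<open>The root of a rooted tree is the only vertex without an incoming edge, so it is determined
  by the edge set, and a uniform rooted tree is a uniform element of \<open>rooted_trees V\<close>.\<close>

definition rooted_trees :: "'a set \<Rightarrow> 'a rel set" where
  "rooted_trees V =
    {E. E \<subseteq> V \<times> V \<and>
        (\<exists>r\<in>V. (\<forall>v\<in>V. (r, v) \<in> E\<^sup>*) \<and>
               (\<nexists>u. (u, r) \<in> E) \<and>
               (\<forall>v\<in>V - {r}. \<exists>!u. (u, v) \<in> E))}"

definition tree_construction :: "nat \<Rightarrow> nat rel pmf" where
  "tree_construction n =
    do {
      T \<leftarrow> pmf_of_set (rooted_trees {1..n - 1});
      w \<leftarrow> pmf_of_set {1..n - 1};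
      \<sigma> \<leftarrow> pmf_of_set {\<sigma>. \<sigma> permutes {1..n}};
      return_pmf (map_prod \<sigma> \<sigma> ` insert (w, n) (T - {(u, v). u > v}))
    }"

end

theory Submission
  imports Defs
begin

text \<open>
  Both sides are compared with a third description of the law, the
  \<^emph>\<open>ranked forest\<close>: every vertex \<open>v\<close> of \<open>{1..n}\<close> picks a parent \<open>g v \<noteq> v\<close>
  uniformly and independently, the vertices receive ranks given by an independent uniform
  permutation \<open>\<rho>\<close>, and the edge from \<open>g v\<close> to \<open>v\<close> is kept if \<open>\<rho> (g v) < \<rho> v\<close>.

  In the Moran chain, \<open>\<rho> v\<close> is the position of \<open>v\<close> when the vertices are ordered by the last time
  at which they were the disconnected vertex, and \<open>g v\<close> is the vertex to which \<open>v\<close> was then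
  attached; the edge has survived exactly if \<open>g v\<close> has not been disconnected since. A step
  with the pair \<open>(u, v)\<close> sets the parent of \<open>v\<close> to \<open>u\<close> and moves \<open>v\<close> to the top rank
  (\<open>ranked_edges_update\<close>). On the finite set of triples of ranks, parents and pairs this update is
  \<open>n (n - 1)\<close>-to-one, so it preserves the uniform distribution of ranks and parents, and the
  ranked forest is stationary (\<open>ranked_forest_stationary\<close>). It is the only stationary law, because
  two chains driven by the same pairs lose at each step, on average, at least a fixed proportion
  of the edges in which they differ (\<open>moran_stationary_unique\<close>).

  On the side of the tree, let \<open>m = n - 1\<close>. A rooted forest with \<open>k\<close> edges on \<open>m\<close> vertices is
  contained in \<open>m ^ (m - k - 1)\<close> rooted trees (\<open>card_trees_containing_forest\<close>, by Pitman's double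
  counting of the ways of growing a forest edge by edge). Hence a uniform rooted tree contains
  \<open>k\<close> prescribed edges with probability \<open>m ^ (- k)\<close> whenever these form a forest, and any set of
  increasing edges with at most one edge into each vertex is a forest. The increasing edges of the
  tree thus have the same containment probabilities as they would have if all vertices chose their
  parents independently, and these probabilities determine a law. Together with the uniform
  attachment of \<open>n\<close> this gives the edges that a ranked forest has when the ranks are the labels
  (\<open>increasing_edges_of_uniform_tree\<close>); the uniform relabelling turns these ranks into a uniform
  permutation.
\<close>

section \<open>Rooted forests and the trees that contain them\<close>

definition rooted_forests :: "'a set \<Rightarrow> 'a rel set" where
  "rooted_forests V = {E. E \<subseteq> V \<times> V \<and> acyclic E \<and> single_valued (E\<inverse>)}"

lemma inj_on_snd_if_single_valued: "single_valued (E\<inverse>) \<Longrightarrow> inj_on snd E"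
  by (auto simp: inj_on_def single_valued_def)

lemma rooted_forests_subset:
  "E \<in> rooted_forests V \<Longrightarrow> E' \<subseteq> E \<Longrightarrow> E' \<in> rooted_forests V"
  unfolding rooted_forests_def
  by (auto intro: acyclic_subset single_valued_subset[of "E'\<inverse>" "E\<inverse>"])

lemma card_roots:
  assumes "finite V" "E \<in> rooted_forests V"
  shows "card (V - Range E) = card V - card E"
proof -
  have "Range E \<subseteq> V" and inj: "inj_on snd E"
    using assms inj_on_snd_if_single_valued by (auto simp: rooted_forests_def)
  moreover have "card (Range E) = card E"
    using card_image[OF inj] by (simp add: Range_snd)
  ultimately show ?thesis
    using assms(1) by (simp add: card_Diff_subset finite_subset)
qed

text \<open>Going from a vertex to its parent as long as there is one never repeats a vertex, and it
  leaves no choice; the walk stops at the root of the component.\<close>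
lemma ex1_root_above:
  assumes "finite V" "E \<in> rooted_forests V" "v \<in> V"
  shows "\<exists>!r. r \<in> V - Range E \<and> (r, v) \<in> E\<^sup>*"
proof -
  have E: "E \<subseteq> V \<times> V" "acyclic E" "single_valued (E\<inverse>)"
    using assms(2) by (auto simp: rooted_forests_def)
  have "wf E"
    using E assms(1) finite_acyclic_wf finite_subset by blast
  have "\<exists>r. r \<in> V - Range E \<and> (r, v) \<in> E\<^sup>*"
    using \<open>wf E\<close> \<open>v \<in> V\<close>
  proof (induction v)
    case (less v)
    show ?case
    proof (cases "v \<in> Range E")
      case True
      then obtain u where "(u, v) \<in> E" by blast
      then show ?thesis
        using less.IH[of u] E(1) by (meson SigmaD1 rtrancl.rtrancl_into_rtrancl subsetD)
    qed (use less.prems in auto)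
  qed
  moreover have "r' = r"
    if "(r, v) \<in> E\<^sup>*" "r \<notin> Range E" "(r', v) \<in> E\<^sup>*" "r' \<notin> Range E" for r r'
    using that
  proof (induction rule: rtrancl_induct)
    case base
    then show ?case by (metis Range.intros rtranclE)
  next
    case (step y z)
    then obtain y' where "(r', y') \<in> E\<^sup>*" "(y', z) \<in> E"
      by (metis Range.intros rtranclE)
    moreover have "y' = y"
      using \<open>(y', z) \<in> E\<close> step.hyps(2) E(3) by (auto simp: single_valued_def)
    ultimately show ?case using step by blast
  qed
  ultimately show ?thesis by blast
qed

lemma card_forest_less:
  assumes "finite V" "V \<noteq> {}" "E \<in> rooted_forests V"
  shows "card E < card V"
proof -
  have "V - Range E \<noteq> {}"
    using ex1_root_above assms by fastforce
  then have "card V - card E > 0"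
    using card_roots[OF assms(1,3)] assms(1) by (metis card_gt_0_iff finite_Diff)
  then show ?thesis by simp
qed

text \<open>Each component of a forest has one root and each edge removes one vertex from the set of
  roots, so a tree is recognised by its number of edges. This makes trees the end points of a
  process that adds edges one at a time.\<close>
lemma rooted_trees_eq_spanning_forests:
  assumes "finite V" "V \<noteq> {}"
  shows "rooted_trees V = {E \<in> rooted_forests V. Suc (card E) = card V}"
proof (intro equalityI subsetI)
  fix E assume "E \<in> rooted_trees V"
  then obtain r where r: "E \<subseteq> V \<times> V" "r \<in> V" "\<And>v. v \<in> V \<Longrightarrow> (r, v) \<in> E\<^sup>*"
      "\<And>u. (u, r) \<notin> E" "\<And>v. v \<in> V - {r} \<Longrightarrow> \<exists>!u. (u, v) \<in> E"
    by (auto simp: rooted_trees_def)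
  have sv: "single_valued (E\<inverse>)"
    unfolding single_valued_def using r by blast
  \<comment> \<open>A cycle through a vertex also runs through its unique parent, hence, going backwards along
    the path from the root, through the root itself, which has no incoming edge.\<close>
  have "(x, x) \<notin> E\<^sup>+" if "(r, x) \<in> E\<^sup>*" for x
    using that
  proof (induction rule: rtrancl_induct)
    case base
    then show ?case using r(4) by (metis tranclD2)
  next
    case (step y z)
    show ?case
    proof
      assume "(z, z) \<in> E\<^sup>+"
      then obtain y' where "(z, y') \<in> E\<^sup>*" "(y', z) \<in> E"
        by (metis tranclD2)
      moreover from this have "y' = y"
        using sv step.hyps(2) by (auto simp: single_valued_def)
      ultimately show False
        using step by (metis rtrancl_into_trancl2)
    qed
  qed
  then have "acyclic E"
    using r(1,3) unfolding acyclic_def by (metis SigmaD1 subsetD tranclD)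
  then have forest: "E \<in> rooted_forests V"
    using r(1) sv by (simp add: rooted_forests_def)
  moreover have "V - Range E = {r}"
    using r(2,4,5) by blast
  ultimately have "card V - card E = 1"
    using card_roots assms(1) by (metis is_singletonI is_singleton_altdef)
  then show "E \<in> {E \<in> rooted_forests V. Suc (card E) = card V}"
    using forest by auto
next
  fix E assume "E \<in> {E \<in> rooted_forests V. Suc (card E) = card V}"
  then have E: "E \<in> rooted_forests V" and "Suc (card E) = card V" by auto
  then have "card (V - Range E) = 1"
    using card_roots[OF assms(1) E] by simp
  then obtain r where r: "V - Range E = {r}"
    by (auto simp: card_1_singleton_iff)
  have "(r, v) \<in> E\<^sup>*" if "v \<in> V" for v
    using ex1_root_above[OF assms(1) E that] unfolding r by auto
  moreover have "\<exists>!u. (u, v) \<in> E" if "v \<in> V - {r}" for v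
  proof -
    have "v \<in> Range E" using r that by blast
    moreover have "single_valued (E\<inverse>)" using E by (simp add: rooted_forests_def)
    ultimately show ?thesis unfolding single_valued_def by blast
  qed
  moreover have "r \<in> V" "\<nexists>u. (u, r) \<in> E" using r by blast+
  moreover have "E \<subseteq> V \<times> V"
    using E by (simp add: rooted_forests_def)
  ultimately show "E \<in> rooted_trees V"
    unfolding rooted_trees_def by (intro CollectI conjI bexI[of _ r]) auto
qed

text \<open>A new edge may start at any vertex \<open>u\<close>, and must end at the root of a component other than
  that of \<open>u\<close>: a vertex that is not a root has a parent already, and an edge to the root of
  the component of \<open>u\<close> closes a cycle.\<close>
lemma card_forest_extensions:
  assumes "finite V" "E \<in> rooted_forests V"
  shows "card {e. e \<notin> E \<and> insert e E \<in> rooted_forests V} = card V * (card V - card E - 1)"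
proof -
  have E: "E \<subseteq> V \<times> V" "acyclic E" "single_valued (E\<inverse>)"
    using assms(2) by (auto simp: rooted_forests_def)
  have "(u, r) \<notin> E \<and> insert (u, r) E \<in> rooted_forests V \<longleftrightarrow>
      u \<in> V \<and> r \<in> V - Range E \<and> (r, u) \<notin> E\<^sup>*" (is "?l \<longleftrightarrow> ?r") for u r
  proof
    assume l: ?l
    then have "single_valued ((insert (u, r) E)\<inverse>)"
      by (simp add: rooted_forests_def)
    then have "r \<notin> Range E"
      using l unfolding single_valued_def by blast
    then show ?r using l by (simp add: rooted_forests_def)
  next
    assume ?r
    moreover from this have "single_valued ((insert (u, r) E)\<inverse>)"
      using E(3) unfolding single_valued_def by blast
    ultimately show ?l using E by (auto simp: rooted_forests_def)
  qed
  then have "{e. e \<notin> E \<and> insert e E \<in> rooted_forests V}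
      = (SIGMA u:V. {r \<in> V - Range E. (r, u) \<notin> E\<^sup>*})"
    by auto
  moreover have "card {r \<in> V - Range E. (r, u) \<notin> E\<^sup>*} = card V - card E - 1"
    if u: "u \<in> V" for u
  proof -
    obtain r0 where "r0 \<in> V - Range E" "(r0, u) \<in> E\<^sup>*"
      "\<And>r. r \<in> V - Range E \<Longrightarrow> (r, u) \<in> E\<^sup>* \<Longrightarrow> r = r0"
      using ex1_root_above[OF assms u] by blast
    then have "{r \<in> V - Range E. (r, u) \<notin> E\<^sup>*} = (V - Range E) - {r0}" "r0 \<in> V - Range E"
      by blast+
    then show ?thesis
      using card_roots[OF assms] by (metis card_Diff_singleton)
  qed
  ultimately show ?thesis
    using assms(1) by simp
qed

lemma finite_rooted_trees: "finite V \<Longrightarrow> finite (rooted_trees V)"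
  by (rule finite_subset[of _ "Pow (V \<times> V)"]) (auto simp: rooted_trees_def)

text \<open>Pitman's argument: count the pairs of a tree \<open>T\<close> containing \<open>E\<close> and an edge \<open>e\<close> of
  \<open>T\<close> outside \<open>E\<close>. If \<open>E\<close> lacks \<open>k + 1\<close> edges to be a tree, then each tree is counted \<open>k + 1\<close>
  times. On the other hand there are \<open>m (k + 1)\<close> possible edges \<open>e\<close>, where \<open>m\<close> is the number of
  vertices, and for each of them the trees containing \<open>E\<close> and \<open>e\<close> are known by induction.
  So each missing edge contributes a factor \<open>m\<close>. For the empty forest this is Cayley's formula.\<close>
theorem card_trees_containing_forest:
  assumes "finite V" "V \<noteq> {}" "E \<in> rooted_forests V"
  shows "card {T \<in> rooted_trees V. E \<subseteq> T} = card V ^ (card V - card E - 1)"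
  using assms(3)
proof (induction "card V - card E - 1" arbitrary: E)
  case 0
  have finE: "finite T" if "T \<in> rooted_forests V" for T
    using that assms(1) by (auto simp: rooted_forests_def intro: finite_subset)
  have "Suc (card E) = card V"
    using 0 card_forest_less[OF assms(1,2)] by fastforce
  then have "{T \<in> rooted_trees V. E \<subseteq> T} = {E}"
    unfolding rooted_trees_eq_spanning_forests[OF assms(1,2)]
    using 0(2) by (auto dest: card_subset_eq[OF finE])
  then show ?case using 0(1) by simp
next
  case (Suc k)
  let ?trees = "{T \<in> rooted_trees V. E \<subseteq> T}"
  let ?ext = "{e. e \<notin> E \<and> insert e E \<in> rooted_forests V}"
  have fin: "finite T" if "T \<in> rooted_forests V" for T
    using that assms(1) by (auto simp: rooted_forests_def intro: finite_subset)
  have "?ext \<subseteq> V \<times> V"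
    by (auto simp: rooted_forests_def)
  then have "finite ?ext"
    using assms(1) by (auto intro: finite_subset)
  have "(\<Sum>T\<in>?trees. card {e \<in> ?ext. e \<in> T}) = card V ^ k * card ?ext"
  proof (rule sum_multicount)
    show "finite ?trees" using assms(1) by (simp add: finite_rooted_trees)
    show "finite ?ext" by fact
    show "\<forall>e\<in>?ext. card {T \<in> ?trees. e \<in> T} = card V ^ k"
    proof
      fix e assume e: "e \<in> ?ext"
      then have "card (insert e E) = Suc (card E)"
        using fin[OF Suc.prems] by simp
      then have "card {T \<in> rooted_trees V. insert e E \<subseteq> T} = card V ^ k"
        using Suc.hyps(1)[of "insert e E"] Suc.hyps(2) e by auto
      then show "card {T \<in> ?trees. e \<in> T} = card V ^ k"
        by (simp add: conj_assoc conj_commute[of "e \<in> _"])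
    qed
  qed
  moreover have "card {e \<in> ?ext. e \<in> T} = Suc k" if T: "T \<in> ?trees" for T
  proof -
    have T': "T \<in> rooted_forests V" "Suc (card T) = card V" "E \<subseteq> T"
      using T rooted_trees_eq_spanning_forests[OF assms(1,2)] by auto
    then have "{e \<in> ?ext. e \<in> T} = T - E"
      by (auto intro: rooted_forests_subset[OF T'(1)])
    then show ?thesis
      using T' fin Suc.prems Suc.hyps(2) by (simp add: card_Diff_subset)
  qed
  moreover have "card ?ext = card V * Suc k"
    using card_forest_extensions[OF assms(1) Suc.prems] Suc.hyps(2) by simp
  ultimately have "card ?trees * Suc k = card V ^ Suc k * Suc k"
    by (simp add: algebra_simps)
  then have "card ?trees = card V ^ Suc k"
    by (metis mult_cancel2 nat.distinct(1))
  then show ?case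
    using Suc.hyps(2) by metis
qed

lemma card_rooted_trees:
  assumes "finite V" "V \<noteq> {}"
  shows "card (rooted_trees V) = card V ^ (card V - 1)"
proof -
  have "{} \<in> rooted_forests V"
    by (simp add: rooted_forests_def acyclic_def)
  then show ?thesis
    using card_trees_containing_forest[OF assms, of "{}"] by simp
qed

lemma rooted_trees_nonempty:
  assumes "finite V" "V \<noteq> {}"
  shows "rooted_trees V \<noteq> {}"
proof
  assume "rooted_trees V = {}"
  then show False using card_rooted_trees[OF assms] assms by simp
qed

section \<open>Comparing and transporting finite distributions\<close>

text \<open>Moebius inversion on the subsets of \<open>U\<close>: the probability of \<open>E\<close> itself is that of
  containing \<open>E\<close>, minus the probabilities of the proper supersets of \<open>E\<close>.\<close>
lemma pmf_eq_if_superset_prob_eq: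
  fixes p q :: "'a set pmf"
  assumes U: "finite U" "set_pmf p \<subseteq> Pow U" "set_pmf q \<subseteq> Pow U"
    and eq: "\<And>E. E \<subseteq> U \<Longrightarrow> measure p {X. E \<subseteq> X} = measure q {X. E \<subseteq> X}"
  shows "p = q"
proof (rule pmf_eqI)
  have split: "measure r {X. E \<subseteq> X} = pmf r E + (\<Sum>X\<in>{X. E \<subset> X \<and> X \<subseteq> U}. pmf r X)"
    if "set_pmf r \<subseteq> Pow U" "E \<subseteq> U" for r :: "'a set pmf" and E
  proof -
    have "measure r {X. E \<subseteq> X} = measure r (insert E {X. E \<subset> X \<and> X \<subseteq> U})"
      using that by (intro measure_pmf.finite_measure_eq_AE) (auto simp: AE_measure_pmf_iff)
    also have "\<dots> = pmf r E + (\<Sum>X\<in>{X. E \<subset> X \<and> X \<subseteq> U}. pmf r X)"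
      using U(1) by (simp add: measure_measure_pmf_finite)
    finally show ?thesis .
  qed
  have "pmf p E = pmf q E" if "E \<subseteq> U" for E
    using that
  proof (induction "card U - card E" arbitrary: E rule: less_induct)
    case less
    have "(\<Sum>X\<in>{X. E \<subset> X \<and> X \<subseteq> U}. pmf p X) = (\<Sum>X\<in>{X. E \<subset> X \<and> X \<subseteq> U}. pmf q X)"
    proof (rule sum.cong[OF refl])
      fix X assume X: "X \<in> {X. E \<subset> X \<and> X \<subseteq> U}"
      then have "card E < card X" "card X \<le> card U"
        using U(1) by (auto intro: psubset_card_mono card_mono finite_subset)
      then show "pmf p X = pmf q X"
        using X by (intro less.hyps) auto
    qed
    then show ?case
      using eq[OF less.prems] split[OF U(2) less.prems] split[OF U(3) less.prems] by simp
  qed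
  moreover have "pmf p E = 0" "pmf q E = 0" if "\<not> E \<subseteq> U" for E
    using that U(2,3) by (auto simp: set_pmf_eq)
  ultimately show "pmf p E = pmf q E" for E
    by (cases "E \<subseteq> U") auto
qed

lemma map_pmf_of_set_equal_fibres:
  assumes "finite A" "A \<noteq> {}" "finite B" "f ` A \<subseteq> B"
    and fibre: "\<And>b. b \<in> B \<Longrightarrow> card {a \<in> A. f a = b} = k"
  shows "map_pmf f (pmf_of_set A) = pmf_of_set B"
proof (rule pmf_eqI)
  fix b
  have "B \<noteq> {}" using assms(2,4) by blast
  have "(\<Sum>a\<in>A. card {b \<in> B. f a = b}) = k * card B"
    using assms(1,3) fibre by (intro sum_multicount) auto
  moreover have "{b \<in> B. f a = b} = {f a}" if "a \<in> A" for a
    using that assms(4) by auto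
  ultimately have "card A = k * card B"
    by simp
  have "measure_pmf.prob (pmf_of_set A) (f -` {b}) = card {a \<in> A. f a = b} / card A"
    using assms(1,2) by (simp add: measure_pmf_of_set Int_def vimage_def)
  moreover have "card {a \<in> A. f a = b} = (if b \<in> B then k else 0)"
  proof (cases "b \<in> B")
    case False
    then have "{a \<in> A. f a = b} = {}" using assms(4) by blast
    then show ?thesis using False by (simp only: if_False card.empty)
  qed (simp add: fibre)
  moreover have "k > 0"
    using \<open>card A = k * card B\<close> assms(1,2) by (metis card_gt_0_iff gr0I mult_zero_left)
  ultimately show "pmf (map_pmf f (pmf_of_set A)) b = pmf (pmf_of_set B) b"
    using \<open>card A = k * card B\<close> \<open>B \<noteq> {}\<close> assms(3) by (simp add: pmf_map indicator_def)
qed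

lemma pmf_of_set_times:
  assumes "finite A" "A \<noteq> {}" "finite B" "B \<noteq> {}"
  shows "pmf_of_set (A \<times> B) = pair_pmf (pmf_of_set A) (pmf_of_set B)"
proof (rule pmf_eqI)
  fix x :: "'a \<times> 'b"
  show "pmf (pmf_of_set (A \<times> B)) x = pmf (pair_pmf (pmf_of_set A) (pmf_of_set B)) x"
    using assms by (cases x) (simp add: pmf_pair indicator_times)
qed

section \<open>Edges from parents to children of larger rank\<close>

text \<open>The value \<open>0\<close> outside \<open>{1..n}\<close> makes such maps equal as soon as they agree on \<open>{1..n}\<close>; since
  permutations of \<open>{1..n}\<close> fix \<open>0\<close>, the set is also closed under conjugation by them.\<close>
definition parent_maps :: "nat \<Rightarrow> (nat \<Rightarrow> nat) set" where
  "parent_maps n = PiE_dflt {1..n} 0 (\<lambda>v. {1..n} - {v})"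

definition ranked_edges :: "nat \<Rightarrow> (nat \<Rightarrow> nat) \<Rightarrow> (nat \<Rightarrow> nat) \<Rightarrow> nat rel" where
  "ranked_edges n \<rho> g = {(g v, v) | v. v \<in> {1..n} \<and> \<rho> (g v) < \<rho> v}"

lemma mem_parent_maps_iff:
  "g \<in> parent_maps n \<longleftrightarrow>
    (\<forall>v\<in>{1..n}. g v \<in> {1..n} \<and> g v \<noteq> v) \<and> (\<forall>v. v \<notin> {1..n} \<longrightarrow> g v = 0)"
  by (auto simp: parent_maps_def PiE_dflt_def)

lemma finite_parent_maps: "finite (parent_maps n)"
  by (auto simp: parent_maps_def intro: finite_PiE_dflt)

lemma card_parent_maps: "card (parent_maps n) = (n - 1) ^ n"
  by (simp add: parent_maps_def card_PiE_dflt)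

lemma parent_maps_nonempty:
  assumes "n \<ge> 2"
  shows "parent_maps n \<noteq> {}"
proof
  assume "parent_maps n = {}"
  then show False using card_parent_maps[of n] assms by simp
qed

lemma card_parent_maps_extending:
  assumes E: "E \<subseteq> {1..n} \<times> {1..n}" "irrefl E" "single_valued (E\<inverse>)"
  shows "card {g \<in> parent_maps n. \<forall>(u, v) \<in> E. g v = u} = (n - 1) ^ (n - card E)"
proof -
  let ?B = "\<lambda>v. if v \<in> Range E then {u. (u, v) \<in> E} else {1..n} - {v}"
  have "{g \<in> parent_maps n. \<forall>(u, v) \<in> E. g v = u} = PiE_dflt {1..n} 0 ?B" (is "?L = ?R")
  proof (intro equalityI subsetI)
    fix g assume "g \<in> ?L"
    then show "g \<in> ?R"
      by (auto simp: parent_maps_def PiE_dflt_def)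
  next
    fix g assume g: "g \<in> ?R"
    then have gB: "g v \<in> ?B v" if "v \<in> {1..n}" for v
      using that unfolding PiE_dflt_def by blast
    have "g v = u" if "(u, v) \<in> E" for u v
    proof -
      have "v \<in> {1..n}" "v \<in> Range E" using that E(1) by auto
      then have "(g v, v) \<in> E" using gB[of v] by simp
      then show ?thesis using E(3) that by (simp add: single_valued_def)
    qed
    moreover have "g v \<in> {1..n} - {v}" if "v \<in> {1..n}" for v
    proof (cases "v \<in> Range E")
      case True
      then have "(g v, v) \<in> E" using gB[of v] that by simp
      then show ?thesis using E(1,2) by (auto simp: irrefl_def)
    qed (use gB[of v] that in simp)
    moreover have "g v = 0" if "v \<notin> {1..n}" for v
      using g that by (simp add: PiE_dflt_def)
    ultimately show "g \<in> ?L"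
      by (auto simp: mem_parent_maps_iff)
  qed
  moreover have "finite (?B v)" for v
  proof (cases "v \<in> Range E")
    case True
    have "{u. (u, v) \<in> E} \<subseteq> {1..n}" using E(1) by blast
    then have "finite {u. (u, v) \<in> E}" using finite_subset by blast
    then show ?thesis using True by simp
  qed simp
  ultimately have "card {g \<in> parent_maps n. \<forall>(u, v) \<in> E. g v = u} = (\<Prod>v\<in>{1..n}. card (?B v))"
    by (simp add: card_PiE_dflt)
  also have "\<dots> = (\<Prod>v\<in>{1..n}. if v \<in> Range E then 1 else n - 1)"
  proof (rule prod.cong[OF refl])
    fix v assume v: "v \<in> {1..n}"
    show "card (?B v) = (if v \<in> Range E then 1 else n - 1)"
    proof (cases "v \<in> Range E")
      case True
      then obtain u where "(u, v) \<in> E" by blast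
      then have "{u. (u, v) \<in> E} = {u}"
        using E(3) by (auto simp: single_valued_def)
      then show ?thesis using True by simp
    qed (use v in simp)
  qed
  also have "\<dots> = (n - 1) ^ card ({1..n} - Range E)"
    by (simp add: prod.If_cases Diff_eq)
  also have "card ({1..n} - Range E) = n - card E"
  proof -
    have "Range E \<subseteq> {1..n}" using E(1) by blast
    moreover have "card (Range E) = card E"
      using card_image[OF inj_on_snd_if_single_valued[OF E(3)]] by (simp add: Range_snd)
    ultimately show ?thesis
      by (simp add: card_Diff_subset finite_subset)
  qed
  finally show ?thesis .
qed

definition ranked_forest :: "nat \<Rightarrow> nat rel pmf" where
  "ranked_forest n = map_pmf (\<lambda>(\<rho>, g). ranked_edges n \<rho> g)
    (pmf_of_set ({\<rho>. \<rho> permutes {1..n}} \<times> parent_maps n))"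

section \<open>The increasing edges of a uniform rooted tree\<close>

text \<open>The first two steps of the construction, before the relabelling.\<close>
abbreviation prune_and_attach :: "nat \<Rightarrow> nat rel \<times> nat \<Rightarrow> nat rel" where
  "prune_and_attach n \<equiv> (\<lambda>(T, w). insert (w, n) (T - {(u, v). u > v}))"

text \<open>If no vertex has two parents in \<open>E\<close>, then containing \<open>E\<close> prescribes the values of \<open>card E\<close>
  independent parents, each of which has \<open>n - 1\<close> equally likely values.\<close>
lemma prob_ranked_edges_superset:
  assumes n: "n \<ge> 2" and E: "E \<subseteq> {(u, v). u \<in> {1..n} \<and> v \<in> {1..n} \<and> u < v}"
  shows "measure_pmf.prob (map_pmf (ranked_edges n id) (pmf_of_set (parent_maps n))) {X. E \<subseteq> X} =
    (if single_valued (E\<inverse>) then 1 / real (n - 1) ^ card E else 0)"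
proof -
  note ne = parent_maps_nonempty[OF n]
  have "(E \<subseteq> ranked_edges n id g) = (\<forall>(u, v) \<in> E. g v = u)" for g
  proof
    assume "E \<subseteq> ranked_edges n id g"
    then show "\<forall>(u, v) \<in> E. g v = u" by (auto simp: ranked_edges_def)
  next
    assume g: "\<forall>(u, v) \<in> E. g v = u"
    show "E \<subseteq> ranked_edges n id g"
    proof
      fix e assume "e \<in> E"
      obtain u v where uv: "e = (u, v)" by (cases e)
      then have "v \<in> {1..n}" "u < v" using E \<open>e \<in> E\<close> by auto
      moreover have "g v = u" using g uv \<open>e \<in> E\<close> by auto
      ultimately show "e \<in> ranked_edges n id g" using uv by (simp add: ranked_edges_def)
    qed
  qed
  then have "measure_pmf.prob (map_pmf (ranked_edges n id) (pmf_of_set (parent_maps n))) {X. E \<subseteq> X}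
    = card {g \<in> parent_maps n. \<forall>(u, v) \<in> E. g v = u} / (n - 1) ^ n"
    using ne by (simp add: measure_pmf_of_set finite_parent_maps card_parent_maps vimage_def Int_def)
  also have "\<dots> = (if single_valued (E\<inverse>) then 1 / real (n - 1) ^ card E else 0)"
  proof (cases "single_valued (E\<inverse>)")
    case True
    have sub: "E \<subseteq> {1..n} \<times> {1..n}" and "irrefl E"
      using E by (auto simp: irrefl_def)
    have "card E = card (snd ` E)"
      using card_image[OF inj_on_snd_if_single_valued[OF True]] by simp
    also have "\<dots> \<le> card {1..n}"
      using sub by (intro card_mono) auto
    finally have "card E \<le> n" by simp
    then have "real (n - 1) ^ n = real (n - 1) ^ (n - card E) * real (n - 1) ^ card E"
      by (simp flip: power_add)
    then show ?thesis
      using card_parent_maps_extending[OF sub \<open>irrefl E\<close> True] True n by simp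
  next
    case False
    then obtain u u' v where "(u, v) \<in> E" "(u', v) \<in> E" "u \<noteq> u'"
      by (auto simp: single_valued_def)
    then have "\<not> (\<forall>(u, v) \<in> E. g v = u)" for g
      by (metis case_prodD)
    then have "{g \<in> parent_maps n. \<forall>(u, v) \<in> E. g v = u} = {}"
      by blast
    then show ?thesis using False by (simp only: card.empty of_nat_0 div_0 if_False)
  qed
  finally show ?thesis .
qed

text \<open>The edge of \<open>E\<close> into \<open>n\<close>, if there is one, prescribes \<open>w\<close>. The other edges are increasing, so
  pruning does not affect whether they are present, and they form a forest on \<open>{1..n - 1}\<close> because
  labels grow along them; the number of trees containing them is known.\<close>
lemma prob_prune_and_attach_superset:
  assumes n: "n \<ge> 2" and E: "E \<subseteq> {(u, v). u \<in> {1..n} \<and> v \<in> {1..n} \<and> u < v}"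
  shows "measure_pmf.prob (map_pmf (prune_and_attach n)
      (pmf_of_set (rooted_trees {1..n - 1} \<times> {1..n - 1}))) {X. E \<subseteq> X} =
    (if single_valued (E\<inverse>) then 1 / real (n - 1) ^ card E else 0)"
proof -
  define m where "m = n - 1"
  have m: "m \<ge> 1" "n = Suc m" "{1..m} \<noteq> {}" using n by (auto simp: m_def)
  define E' where "E' = {(u, v) \<in> E. v \<noteq> n}"
  define W where "W = {w \<in> {1..m}. \<forall>u. (u, n) \<in> E \<longrightarrow> u = w}"
  have "finite E"
    by (rule finite_subset[of _ "{1..n} \<times> {1..n}"]) (use E in auto)
  have cayley: "card (rooted_trees {1..m}) = m ^ (m - 1)"
    using card_rooted_trees[of "{1..m}"] m(3) by simp
  have ne: "rooted_trees {1..m} \<noteq> {}"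
    using rooted_trees_nonempty[of "{1..m}"] m(3) by simp
  have iff: "E \<subseteq> prune_and_attach n (T, w) \<longleftrightarrow> E' \<subseteq> T \<and> w \<in> W"
    if T: "T \<in> rooted_trees {1..m}" and w: "w \<in> {1..m}" for T w
  proof -
    have "(u, n) \<notin> T" for u
      using T m(2) by (auto simp: rooted_trees_def)
    then have "E \<subseteq> prune_and_attach n (T, w) \<longleftrightarrow> (\<forall>(u, v) \<in> E. if v = n then u = w else (u, v) \<in> T)"
      using E by (auto split: if_splits)
    also have "\<dots> \<longleftrightarrow> E' \<subseteq> T \<and> (\<forall>u. (u, n) \<in> E \<longrightarrow> u = w)"
      unfolding E'_def by (auto split: if_splits)
    finally show ?thesis
      using w by (simp add: W_def)
  qed
  have "{x \<in> rooted_trees {1..m} \<times> {1..m}. E \<subseteq> prune_and_attach n x}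
      = {T \<in> rooted_trees {1..m}. E' \<subseteq> T} \<times> W" (is "?L = ?R")
  proof (intro equalityI subsetI)
    fix x assume "x \<in> ?L"
    then obtain T w where x: "x = (T, w)" "T \<in> rooted_trees {1..m}" "w \<in> {1..m}"
        "E \<subseteq> prune_and_attach n (T, w)"
      by blast
    then show "x \<in> ?R" using iff[OF x(2,3)] by blast
  next
    fix x assume "x \<in> ?R"
    then obtain T w where x: "x = (T, w)" "T \<in> rooted_trees {1..m}" "E' \<subseteq> T" "w \<in> W"
      by blast
    then have w: "w \<in> {1..m}" by (simp add: W_def)
    have "E \<subseteq> prune_and_attach n (T, w)"
      using iff[OF x(2) w] x(3,4) by blast
    then show "x \<in> ?L" using x(1,2) w by blast
  qed
  moreover have "measure_pmf.prob (map_pmf (prune_and_attach n)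
      (pmf_of_set (rooted_trees {1..m} \<times> {1..m}))) {X. E \<subseteq> X}
    = card {x \<in> rooted_trees {1..m} \<times> {1..m}. E \<subseteq> prune_and_attach n x} /
      card (rooted_trees {1..m} \<times> {1..m})"
    using ne m(3) by (simp add: measure_pmf_of_set finite_rooted_trees vimage_def Int_def)
  moreover have "card (rooted_trees {1..m} \<times> {1..m}) = m ^ m"
    using cayley m(1) by (simp add: card_cartesian_product flip: power_Suc2)
  then have "real (card (rooted_trees {1..m} \<times> {1..m})) = real m ^ m"
    by simp
  ultimately have prob: "measure_pmf.prob (map_pmf (prune_and_attach n)
      (pmf_of_set (rooted_trees {1..m} \<times> {1..m}))) {X. E \<subseteq> X}
    = card {T \<in> rooted_trees {1..m}. E' \<subseteq> T} * card W / m ^ m"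
    by (simp only: card_cartesian_product of_nat_power)
  show ?thesis
  proof (cases "single_valued (E\<inverse>)")
    case True
    have "E' \<subseteq> {1..m} \<times> {1..m}"
    proof
      fix x assume "x \<in> E'"
      then show "x \<in> {1..m} \<times> {1..m}"
        using E m(2) by (cases x) (force simp: E'_def)
    qed
    moreover have "acyclic E'"
    proof (rule acyclic_subset[OF wf_acyclic[OF wf_less]])
      show "E' \<subseteq> {(x, y). x < y}" using E by (auto simp: E'_def)
    qed
    moreover have "single_valued (E'\<inverse>)"
      using True unfolding E'_def single_valued_def by blast
    ultimately have forest: "E' \<in> rooted_forests {1..m}"
      by (simp add: rooted_forests_def)
    have less: "card E' < m"
      using card_forest_less[OF _ m(3) forest] by simp
    have trees: "card {T \<in> rooted_trees {1..m}. E' \<subseteq> T} = m ^ (m - card E' - 1)"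
      using card_trees_containing_forest[OF _ m(3) forest] by simp
    \<comment> \<open>An edge into \<open>n\<close> costs a factor \<open>m\<close> in the choice of \<open>w\<close>, just as any other edge does in
      the choice of the tree.\<close>
    have "card {T \<in> rooted_trees {1..m}. E' \<subseteq> T} * card W * m ^ card E = m ^ m"
    proof (cases "n \<in> Range E")
      case True
      then obtain w where w: "(w, n) \<in> E" by blast
      have uniq: "u = w" if "(u, n) \<in> E" for u
        using \<open>single_valued (E\<inverse>)\<close> that w unfolding single_valued_def by blast
      from E w have "(w, n) \<in> {(u, v). u \<in> {1..n} \<and> v \<in> {1..n} \<and> u < v}"
        by (rule subsetD)
      then have "w \<in> {1..m}" using m(2) by simp
      then have "W = {w}"
        using w unfolding W_def by (auto dest: uniq)
      have "E = insert (w, n) E'" "(w, n) \<notin> E'"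
        using w unfolding E'_def by (auto dest: uniq)
      moreover have "finite E'" using \<open>finite E\<close> by (rule rev_finite_subset) (auto simp: E'_def)
      ultimately have "card E = Suc (card E')" by simp
      then have "m - card E' - 1 + card E = m"
        using less by simp
      then show ?thesis
        unfolding trees \<open>W = {w}\<close> by (simp flip: power_add)
    next
      case False
      then have W: "W = {1..m}" and "E' = E"
        unfolding W_def E'_def by auto
      have "m - card E' - 1 + 1 + card E' = m"
        using less by simp
      then have "m ^ (m - card E' - 1) * m ^ 1 * m ^ card E' = m ^ m"
        by (simp only: flip: power_add)
      then show ?thesis
        unfolding trees W \<open>E' = E\<close>[symmetric] by simp
    qed
    then have "real (card {T \<in> rooted_trees {1..m}. E' \<subseteq> T} * card W) * real m ^ card E = real m ^ m"
      by (simp only: flip: of_nat_mult of_nat_power)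
    then have "real (card {T \<in> rooted_trees {1..m}. E' \<subseteq> T} * card W) / real m ^ m = 1 / real m ^ card E"
      using m(1) by (simp add: frac_eq_eq)
    then show ?thesis
      unfolding m_def[symmetric] prob using True by simp
  next
    case False
    have "\<not> (E' \<subseteq> T \<and> w \<in> W)" if T: "T \<in> rooted_trees {1..m}" for T w
    proof -
      obtain u u' v where uv: "(u, v) \<in> E" "(u', v) \<in> E" "u \<noteq> u'"
        using False by (auto simp: single_valued_def)
      have "single_valued (T\<inverse>)"
        using T rooted_trees_eq_spanning_forests[OF _ m(3)] by (simp add: rooted_forests_def)
      then have "(u, v) \<notin> T \<or> (u', v) \<notin> T"
        using uv(3) unfolding single_valued_def by blast
      then show ?thesis
        using uv unfolding E'_def W_def by (cases "v = n") auto
    qed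
    then have "{T \<in> rooted_trees {1..m}. E' \<subseteq> T} = {} \<or> W = {}"
      by blast
    then have "card {T \<in> rooted_trees {1..m}. E' \<subseteq> T} * card W = 0"
      by (elim disjE) (simp_all only: card.empty mult_0 mult_0_right)
    then show ?thesis unfolding m_def[symmetric] prob using False by simp
  qed
qed

text \<open>The containment probabilities of the two random sets of edges agree, so their laws do. On the
  left the edge into \<open>n\<close> is always present because \<open>n\<close> is the largest label; it plays the part of
  the uniformly attached last vertex.\<close>
theorem increasing_edges_of_uniform_tree:
  assumes n: "n \<ge> 2"
  shows "map_pmf (ranked_edges n id) (pmf_of_set (parent_maps n)) =
    map_pmf (prune_and_attach n) (pmf_of_set (rooted_trees {1..n - 1} \<times> {1..n - 1}))"
    (is "?p = ?q")
proof (rule pmf_eq_if_superset_prob_eq)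
  let ?U = "{(u, v). u \<in> {1..n} \<and> v \<in> {1..n} \<and> u < v}"
  show "finite ?U"
    by (rule finite_subset[of _ "{1..n} \<times> {1..n}"]) auto
  show "measure_pmf.prob ?p {X. E \<subseteq> X} = measure_pmf.prob ?q {X. E \<subseteq> X}" if "E \<subseteq> ?U" for E
    using prob_ranked_edges_superset[OF n that] prob_prune_and_attach_superset[OF n that] by simp
  have finite_ne: "parent_maps n \<noteq> {}" "finite (parent_maps n)"
    using parent_maps_nonempty[OF n] finite_parent_maps by auto
  have "ranked_edges n id g \<subseteq> ?U" if "g \<in> parent_maps n" for g
    using that by (auto simp: ranked_edges_def mem_parent_maps_iff)
  then show "set_pmf ?p \<subseteq> Pow ?U"
    using finite_ne by auto
  have ne: "{1..n - 1} \<noteq> {}" using n by simp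
  have "prune_and_attach n (T, w) \<subseteq> ?U" if "T \<in> rooted_trees {1..n - 1}" "w \<in> {1..n - 1}" for T w
  proof -
    have T: "T \<subseteq> {1..n - 1} \<times> {1..n - 1}" "acyclic T"
      using that(1) rooted_trees_eq_spanning_forests[OF _ ne] by (auto simp: rooted_forests_def)
    have "u \<in> {1..n} \<and> v \<in> {1..n} \<and> u < v" if "(u, v) \<in> T" "\<not> v < u" for u v
    proof -
      have "u \<noteq> v" using T(2) that(1) by (auto simp: acyclic_def)
      moreover have "u \<in> {1..n - 1}" "v \<in> {1..n - 1}" using T(1) that(1) by blast+
      ultimately show ?thesis using that(2) by auto
    qed
    then show ?thesis using that(2) n by auto
  qed
  then show "set_pmf ?q \<subseteq> Pow ?U"
    using rooted_trees_nonempty[of "{1..n - 1}"] ne by (auto simp: finite_rooted_trees)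
qed

section \<open>Relabelling by a uniform permutation\<close>

lemma tree_construction_eq:
  assumes n: "n \<ge> 2"
  shows "tree_construction n =
    bind_pmf (pmf_of_set {\<sigma>. \<sigma> permutes {1..n}}) (\<lambda>\<sigma>.
      map_pmf (\<lambda>x. map_prod \<sigma> \<sigma> ` prune_and_attach n x)
        (pmf_of_set (rooted_trees {1..n - 1} \<times> {1..n - 1})))"
proof -
  have "{1..n - 1} \<noteq> {}" using n by simp
  then have "pmf_of_set (rooted_trees {1..n - 1} \<times> {1..n - 1})
      = pair_pmf (pmf_of_set (rooted_trees {1..n - 1})) (pmf_of_set {1..n - 1})"
    by (intro pmf_of_set_times finite_rooted_trees rooted_trees_nonempty) simp_all
  then have "tree_construction n =
    bind_pmf (pmf_of_set (rooted_trees {1..n - 1} \<times> {1..n - 1})) (\<lambda>x.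
      bind_pmf (pmf_of_set {\<sigma>. \<sigma> permutes {1..n}}) (\<lambda>\<sigma>.
        return_pmf (map_prod \<sigma> \<sigma> ` prune_and_attach n x)))"
    by (simp only: tree_construction_def pair_pmf_def bind_assoc_pmf bind_return_pmf prod.case)
  then show ?thesis
    by (subst (asm) bind_commute_pmf) (simp only: map_pmf_def)
qed

text \<open>Renaming the vertices by \<open>\<sigma>\<close> conjugates the parent map, and the old label of a vertex, its
  image under \<open>inv \<sigma>\<close>, becomes its rank.\<close>
lemma image_ranked_edges:
  assumes \<sigma>: "\<sigma> permutes {1..n}"
  shows "map_prod \<sigma> \<sigma> ` ranked_edges n id g = ranked_edges n (inv \<sigma>) (\<sigma> \<circ> g \<circ> inv \<sigma>)"
proof (intro equalityI subsetI)
  fix e assume "e \<in> map_prod \<sigma> \<sigma> ` ranked_edges n id g"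
  then obtain v where v: "v \<in> {1..n}" "g v < v" and e: "e = (\<sigma> (g v), \<sigma> v)"
    by (auto simp: ranked_edges_def)
  have "\<sigma> v \<in> {1..n}" using v(1) by (simp only: permutes_in_image[OF \<sigma>])
  then show "e \<in> ranked_edges n (inv \<sigma>) (\<sigma> \<circ> g \<circ> inv \<sigma>)"
    unfolding ranked_edges_def
    by (intro CollectI exI[of _ "\<sigma> v"]) (simp add: e v(2) permutes_inverses[OF \<sigma>])
next
  fix e assume "e \<in> ranked_edges n (inv \<sigma>) (\<sigma> \<circ> g \<circ> inv \<sigma>)"
  then obtain x where x: "x \<in> {1..n}" "g (inv \<sigma> x) < inv \<sigma> x" and e: "e = (\<sigma> (g (inv \<sigma> x)), x)"
    by (auto simp: ranked_edges_def permutes_inverses[OF \<sigma>])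
  have "inv \<sigma> x \<in> {1..n}" using x(1) by (simp only: permutes_in_image[OF permutes_inv[OF \<sigma>]])
  then have "(g (inv \<sigma> x), inv \<sigma> x) \<in> ranked_edges n id g"
    unfolding ranked_edges_def using x(2) by auto
  then show "e \<in> map_prod \<sigma> \<sigma> ` ranked_edges n id g"
    by (rule rev_image_eqI) (simp add: e permutes_inverses[OF \<sigma>])
qed

lemma conjugate_parent_map:
  assumes \<sigma>: "\<sigma> permutes {1..n}" and g: "g \<in> parent_maps n"
  shows "\<sigma> \<circ> g \<circ> inv \<sigma> \<in> parent_maps n"
  unfolding mem_parent_maps_iff
proof (intro conjI ballI allI impI)
  fix v assume "v \<in> {1..n}"
  then have "inv \<sigma> v \<in> {1..n}" by (simp only: permutes_in_image[OF permutes_inv[OF \<sigma>]])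
  then have *: "g (inv \<sigma> v) \<in> {1..n}" "g (inv \<sigma> v) \<noteq> inv \<sigma> v"
    using g by (auto simp: mem_parent_maps_iff)
  then show "(\<sigma> \<circ> g \<circ> inv \<sigma>) v \<in> {1..n}"
    by (simp only: o_apply permutes_in_image[OF \<sigma>])
  show "(\<sigma> \<circ> g \<circ> inv \<sigma>) v \<noteq> v"
    using *(2) by (metis o_apply permutes_inverses(2)[OF \<sigma>])
next
  fix v assume v: "v \<notin> {1..n}"
  then have "inv \<sigma> v = v" "g v = 0" "\<sigma> 0 = 0"
    using permutes_not_in[OF permutes_inv[OF \<sigma>]] permutes_not_in[OF \<sigma>] g
    by (auto simp: mem_parent_maps_iff)
  then show "(\<sigma> \<circ> g \<circ> inv \<sigma>) v = 0" by simp
qed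

text \<open>The conjugate of a uniform parent map is thus uniform for each \<open>\<sigma>\<close>; this keeps the parents
  independent of the ranks when the vertices are renamed by a random permutation.\<close>
lemma bij_betw_conjugate_parent_maps:
  assumes \<sigma>: "\<sigma> permutes {1..n}"
  shows "bij_betw (\<lambda>g. \<sigma> \<circ> g \<circ> inv \<sigma>) (parent_maps n) (parent_maps n)"
proof (rule bij_betw_byWitness[where f' = "\<lambda>g. inv \<sigma> \<circ> g \<circ> \<sigma>"])
  show "(\<lambda>g. inv \<sigma> \<circ> g \<circ> \<sigma>) ` parent_maps n \<subseteq> parent_maps n"
    using conjugate_parent_map[OF permutes_inv[OF \<sigma>]] by (auto simp: permutes_inv_inv[OF \<sigma>])
  show "(\<lambda>g. \<sigma> \<circ> g \<circ> inv \<sigma>) ` parent_maps n \<subseteq> parent_maps n"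
    using conjugate_parent_map[OF \<sigma>] by blast
qed (auto simp: fun_eq_iff permutes_inverses[OF \<sigma>])

lemma tree_construction_eq_ranked_forest:
  assumes n: "n \<ge> 2"
  shows "tree_construction n = ranked_forest n"
proof -
  let ?P = "{\<sigma>. \<sigma> permutes {1..n}}"
  let ?G = "parent_maps n"
  have P: "?P \<noteq> {}" "finite ?P"
    using permutes_id by (blast, simp add: finite_permutations)
  note G = parent_maps_nonempty[OF n] finite_parent_maps[of n]
  have conj: "map_pmf (\<lambda>x. map_prod \<sigma> \<sigma> ` prune_and_attach n x)
        (pmf_of_set (rooted_trees {1..n - 1} \<times> {1..n - 1}))
      = map_pmf (\<lambda>g. ranked_edges n (inv \<sigma>) g) (pmf_of_set ?G)" if \<sigma>: "\<sigma> permutes {1..n}" for \<sigma>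
  proof -
    have "map_pmf (\<lambda>x. map_prod \<sigma> \<sigma> ` prune_and_attach n x)
        (pmf_of_set (rooted_trees {1..n - 1} \<times> {1..n - 1}))
      = map_pmf ((`) (map_prod \<sigma> \<sigma>)) (map_pmf (ranked_edges n id) (pmf_of_set ?G))"
      by (simp only: increasing_edges_of_uniform_tree[OF n] map_pmf_comp)
    also have "\<dots> = map_pmf (\<lambda>g. ranked_edges n (inv \<sigma>) (\<sigma> \<circ> g \<circ> inv \<sigma>)) (pmf_of_set ?G)"
      by (simp only: map_pmf_comp image_ranked_edges[OF \<sigma>])
    also have "\<dots> = map_pmf (\<lambda>g. ranked_edges n (inv \<sigma>) g) (map_pmf (\<lambda>g. \<sigma> \<circ> g \<circ> inv \<sigma>) (pmf_of_set ?G))"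
      by (simp only: map_pmf_comp)
    also have "map_pmf (\<lambda>g. \<sigma> \<circ> g \<circ> inv \<sigma>) (pmf_of_set ?G) = pmf_of_set ?G"
      by (rule map_pmf_of_set_bij_betw[OF bij_betw_conjugate_parent_maps[OF \<sigma>] G])
    finally show ?thesis .
  qed
  have "bij_betw inv ?P ?P"
    by (rule bij_betw_byWitness[where f' = inv]) (auto simp: permutes_inv permutes_inv_inv)
  then have inv: "map_pmf inv (pmf_of_set ?P) = pmf_of_set ?P"
    by (rule map_pmf_of_set_bij_betw[OF _ P])
  have "tree_construction n =
      bind_pmf (pmf_of_set ?P) (\<lambda>\<sigma>. map_pmf (\<lambda>g. ranked_edges n (inv \<sigma>) g) (pmf_of_set ?G))"
    unfolding tree_construction_eq[OF n]
    using P by (intro bind_pmf_cong[OF refl] conj) simp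
  also have "\<dots> = bind_pmf (map_pmf inv (pmf_of_set ?P)) (\<lambda>\<rho>. map_pmf (ranked_edges n \<rho>) (pmf_of_set ?G))"
    by (simp only: bind_map_pmf)
  also have "\<dots> = map_pmf (\<lambda>(\<rho>, g). ranked_edges n \<rho> g) (pair_pmf (pmf_of_set ?P) (pmf_of_set ?G))"
    unfolding inv
    by (simp only: pair_pmf_def map_pmf_def bind_assoc_pmf bind_return_pmf prod.case)
  also have "\<dots> = ranked_forest n"
    unfolding ranked_forest_def by (simp only: pmf_of_set_times[OF P(2,1) G(2,1)])
  finally show ?thesis .
qed

section \<open>Stationarity of the ranked forest\<close>

abbreviation off_diagonal :: "nat \<Rightarrow> (nat \<times> nat) set" where
  "off_diagonal n \<equiv> {(u, v). u \<in> {1..n} \<and> v \<in> {1..n} \<and> u \<noteq> v}"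

lemma finite_off_diagonal: "finite (off_diagonal n)"
  by (rule finite_subset[of _ "{1..n} \<times> {1..n}"]) auto

lemma off_diagonal_nonempty: "n \<ge> 2 \<Longrightarrow> off_diagonal n \<noteq> {}"
proof -
  assume "n \<ge> 2"
  then have "(1, 2) \<in> off_diagonal n" by simp
  then show ?thesis by blast
qed

abbreviation update_edges :: "nat \<times> nat \<Rightarrow> nat rel \<Rightarrow> nat rel" where
  "update_edges \<equiv> (\<lambda>(u, v) E. insert (u, v) {(a, b) \<in> E. a \<noteq> v \<and> b \<noteq> v})"

lemma moran_step_eq_map:
  "moran_step n E = map_pmf (\<lambda>x. update_edges x E) (pmf_of_set (off_diagonal n))"
  by (simp add: moran_step_def map_pmf_def case_prod_unfold)

lemma update_edges_in_digraphs:
  "E \<in> digraphs {1..n} \<Longrightarrow> x \<in> off_diagonal n \<Longrightarrow> update_edges x E \<in> digraphs {1..n}"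
  by (auto simp: digraphs_def irrefl_def)

lemma finite_digraphs: "finite V \<Longrightarrow> finite (digraphs V)"
  by (rule finite_subset[of _ "Pow (V \<times> V)"]) (auto simp: digraphs_def)

text \<open>The cyclic permutation of ranks that moves rank \<open>k\<close> to the top and closes the gap.\<close>
definition to_top :: "nat \<Rightarrow> nat \<Rightarrow> nat \<Rightarrow> nat" where
  "to_top n k i = (if i = k then n else if k < i \<and> i \<le> n then i - 1 else i)"

lemma to_top_permutes:
  assumes "k \<in> {1..n}"
  shows "to_top n k permutes {1..n}"
proof (rule bij_imp_permutes)
  have "inj_on (to_top n k) {1..n}"
    using assms by (auto simp: inj_on_def to_top_def split: if_splits)
  moreover have "to_top n k ` {1..n} \<subseteq> {1..n}"
    using assms by (auto simp: to_top_def)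
  ultimately show "bij_betw (to_top n k) {1..n} {1..n}"
    by (simp add: bij_betw_def endo_inj_surj)
  show "to_top n k i = i" if "i \<notin> {1..n}" for i
    using assms that by (auto simp: to_top_def)
qed

lemma to_top_less_iff:
  assumes "k \<in> {1..n}" "i \<in> {1..n}" "j \<in> {1..n}"
  shows "to_top n k j < to_top n k i \<longleftrightarrow> j \<noteq> k \<and> (i = k \<or> j < i)"
  using assms by (auto simp: to_top_def)

text \<open>The edge into \<open>v\<close> is kept since \<open>v\<close> has the top rank, and all edges that leave \<open>v\<close> are lost for
  the same reason. Nothing changes elsewhere, because the relative order of the other vertices is
  the same as before.\<close>
lemma ranked_edges_update:
  assumes \<rho>: "\<rho> permutes {1..n}" and g: "g \<in> parent_maps n"
    and u: "u \<in> {1..n}" and v: "v \<in> {1..n}" and "u \<noteq> v"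
  shows "ranked_edges n (to_top n (\<rho> v) \<circ> \<rho>) (g(v := u)) =
    update_edges (u, v) (ranked_edges n \<rho> g)"
proof -
  have in_range: "\<rho> x \<in> {1..n}" if "x \<in> {1..n}" for x
    using that by (simp only: permutes_in_image[OF \<rho>])
  have eq_iff: "\<rho> x = \<rho> y \<longleftrightarrow> x = y" for x y
    using permutes_inj[OF \<rho>] by (auto dest: injD)
  have *: "to_top n (\<rho> v) (\<rho> y) < to_top n (\<rho> v) (\<rho> x) \<longleftrightarrow> y \<noteq> v \<and> (x = v \<or> \<rho> y < \<rho> x)"
    if "x \<in> {1..n}" "y \<in> {1..n}" for x y
    using to_top_less_iff[OF in_range[OF v] in_range[OF that(1)] in_range[OF that(2)]]
    by (simp add: eq_iff)
  have mem: "(a, b) \<in> ranked_edges n \<rho>' g' \<longleftrightarrow> b \<in> {1..n} \<and> a = g' b \<and> \<rho>' a < \<rho>' b" for a b \<rho>' g'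
    by (auto simp: ranked_edges_def)
  have "(a, b) \<in> ranked_edges n (to_top n (\<rho> v) \<circ> \<rho>) (g(v := u)) \<longleftrightarrow>
    (a, b) \<in> update_edges (u, v) (ranked_edges n \<rho> g)" for a b
  proof (cases "b = v")
    case True
    then show ?thesis using *[OF v u] u v \<open>u \<noteq> v\<close> by (auto simp: mem)
  next
    case False
    have "g b \<in> {1..n}" if "b \<in> {1..n}"
      using g that by (simp add: mem_parent_maps_iff)
    then show ?thesis using False *[of b "g b"] by (auto simp: mem)
  qed
  then show ?thesis by (simp add: set_eq_iff split_paired_all)
qed

definition update_ranks_and_parents where
  "update_ranks_and_parents n = (\<lambda>((\<rho>, g), (u, v)). (to_top n (\<rho> v) \<circ> \<rho>, g(v := u)))"

text \<open>Given new ranks \<open>\<rho>'\<close> and parents \<open>g'\<close>, the chosen pair can be read off: \<open>v\<close> is the vertex of top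
  rank and \<open>u = g' v\<close>. What the update has forgotten is the old rank \<open>k\<close> of \<open>v\<close> and the old
  parent \<open>a\<close> of \<open>v\<close>. These are arbitrary, so that all fibres have \<open>n (n - 1)\<close> elements.\<close>
lemma update_preserves_uniform:
  assumes n: "n \<ge> 2"
  shows "map_pmf (update_ranks_and_parents n)
      (pmf_of_set (({\<rho>. \<rho> permutes {1..n}} \<times> parent_maps n) \<times> off_diagonal n))
    = pmf_of_set ({\<rho>. \<rho> permutes {1..n}} \<times> parent_maps n)"
proof (rule map_pmf_of_set_equal_fibres)
  let ?P = "{\<rho>. \<rho> permutes {1..n}}"
  let ?G = "parent_maps n"
  let ?\<Phi> = "update_ranks_and_parents n"
  have idP: "id \<in> ?P" by (simp add: permutes_id)
  have finP: "finite ?P" by (simp add: finite_permutations)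
  show "finite ((?P \<times> ?G) \<times> off_diagonal n)" "finite (?P \<times> ?G)"
    using finP finite_off_diagonal by (auto simp: finite_parent_maps)
  show "(?P \<times> ?G) \<times> off_diagonal n \<noteq> {}"
    using idP parent_maps_nonempty[OF n] off_diagonal_nonempty[OF n] by blast
  have upd: "to_top n (\<rho> v) \<circ> \<rho> \<in> ?P" "g(v := u) \<in> ?G"
    if "\<rho> \<in> ?P" "g \<in> ?G" "u \<in> {1..n}" "v \<in> {1..n}" "u \<noteq> v" for \<rho> g u v
  proof -
    have \<rho>: "\<rho> permutes {1..n}" using that(1) by simp
    then have "\<rho> v \<in> {1..n}" using that(4) by (simp only: permutes_in_image)
    then show "to_top n (\<rho> v) \<circ> \<rho> \<in> ?P"
      using permutes_compose[OF \<rho> to_top_permutes] by blast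
    show "g(v := u) \<in> ?G" using that(2-5) by (simp add: mem_parent_maps_iff)
  qed
  then show "?\<Phi> ` ((?P \<times> ?G) \<times> off_diagonal n) \<subseteq> ?P \<times> ?G"
    by (auto simp: update_ranks_and_parents_def)
  fix b assume "b \<in> ?P \<times> ?G"
  then obtain \<rho>' g' where b: "b = (\<rho>', g')" and \<rho>': "\<rho>' permutes {1..n}" and g': "g' \<in> ?G"
    by blast
  define v where "v = inv \<rho>' n"
  have top: "\<rho>' v = n" unfolding v_def using \<rho>' by (simp add: permutes_inverses)
  have v: "v \<in> {1..n}"
    using top n permutes_in_image[OF \<rho>', of v] by simp
  have "g' v \<in> {1..n}" "g' v \<noteq> v" using g' v by (auto simp: mem_parent_maps_iff)
  let ?\<Psi> = "\<lambda>(k, a). ((inv (to_top n k) \<circ> \<rho>', g'(v := a)), (g' v, v))"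
  have "bij_betw ?\<Psi> ({1..n} \<times> ({1..n} - {v})) {x \<in> (?P \<times> ?G) \<times> off_diagonal n. ?\<Phi> x = b}"
  proof (rule bij_betw_byWitness[where f' = "\<lambda>((\<rho>, g), _). (\<rho> v, g v)"])
    have inv_top: "inv (to_top n k) n = k" if "k \<in> {1..n}" for k
      using permutes_inverses(2)[OF to_top_permutes[OF that], of k] by (simp add: to_top_def)
    then show "\<forall>x \<in> {1..n} \<times> ({1..n} - {v}). (\<lambda>((\<rho>, g), _). (\<rho> v, g v)) (?\<Psi> x) = x"
      by (auto simp: top)
    show "\<forall>x \<in> {x \<in> (?P \<times> ?G) \<times> off_diagonal n. ?\<Phi> x = b}.
        ?\<Psi> ((\<lambda>((\<rho>, g), _). (\<rho> v, g v)) x) = x"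
    proof
      fix x assume x: "x \<in> {x \<in> (?P \<times> ?G) \<times> off_diagonal n. ?\<Phi> x = b}"
      obtain \<rho> g u w where xx: "x = ((\<rho>, g), (u, w))" by (metis prod.exhaust)
      then have p: "\<rho> permutes {1..n}" "u \<in> {1..n}" "w \<in> {1..n}"
        and e: "\<rho>' = to_top n (\<rho> w) \<circ> \<rho>" "g' = g(w := u)"
        using x b by (auto simp: update_ranks_and_parents_def)
      have \<rho>w: "\<rho> w \<in> {1..n}" using p(3) by (simp only: permutes_in_image[OF p(1)])
      have "\<rho>' w = n" using e(1) by (simp add: to_top_def)
      then have "w = v" using top permutes_inj[OF \<rho>'] by (metis injD)
      moreover have "inv (to_top n (\<rho> w)) \<circ> \<rho>' = \<rho>"
        using permutes_inverses(2)[OF to_top_permutes[OF \<rho>w]] e(1) by (auto simp: fun_eq_iff)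
      ultimately show "?\<Psi> ((\<lambda>((\<rho>, g), _). (\<rho> v, g v)) x) = x"
        using xx e(2) by simp
    qed
    show "(\<lambda>((\<rho>, g), _). (\<rho> v, g v)) ` {x \<in> (?P \<times> ?G) \<times> off_diagonal n. ?\<Phi> x = b}
        \<subseteq> {1..n} \<times> ({1..n} - {v})"
    proof (rule image_subsetI)
      fix x assume "x \<in> {x \<in> (?P \<times> ?G) \<times> off_diagonal n. ?\<Phi> x = b}"
      then obtain \<rho> g y where x: "x = ((\<rho>, g), y)" and \<rho>: "\<rho> permutes {1..n}" and g: "g \<in> ?G"
        by blast
      have "\<rho> v \<in> {1..n}" using v by (simp only: permutes_in_image[OF \<rho>])
      then show "(\<lambda>((\<rho>, g), _). (\<rho> v, g v)) x \<in> {1..n} \<times> ({1..n} - {v})"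
        using x g v by (simp add: mem_parent_maps_iff)
    qed
    show "?\<Psi> ` ({1..n} \<times> ({1..n} - {v})) \<subseteq> {x \<in> (?P \<times> ?G) \<times> off_diagonal n. ?\<Phi> x = b}"
    proof (rule image_subsetI)
      fix x assume "x \<in> {1..n} \<times> ({1..n} - {v})"
      then obtain k a where x: "x = (k, a)" and k: "k \<in> {1..n}" and a: "a \<in> {1..n}" "a \<noteq> v"
        by blast
      have "inv (to_top n k) \<circ> \<rho>' permutes {1..n}"
        using \<rho>' to_top_permutes[OF k] by (intro permutes_compose permutes_inv)
      moreover have "g'(v := a) \<in> ?G"
        using g' a v by (auto simp: mem_parent_maps_iff)
      moreover have "to_top n ((inv (to_top n k) \<circ> \<rho>') v) \<circ> (inv (to_top n k) \<circ> \<rho>') = \<rho>'"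
        using inv_top[OF k] permutes_inverses(1)[OF to_top_permutes[OF k]]
        by (auto simp: fun_eq_iff top)
      ultimately show "?\<Psi> x \<in> {x \<in> (?P \<times> ?G) \<times> off_diagonal n. ?\<Phi> x = b}"
        using x b v \<open>g' v \<in> {1..n}\<close> \<open>g' v \<noteq> v\<close> by (simp add: update_ranks_and_parents_def)
    qed
  qed
  then have "card {x \<in> (?P \<times> ?G) \<times> off_diagonal n. ?\<Phi> x = b} = card ({1..n} \<times> ({1..n} - {v}))"
    by (rule bij_betw_same_card[symmetric])
  also have "\<dots> = n * (n - 1)"
    using v by (simp add: card_cartesian_product)
  finally show "card {x \<in> (?P \<times> ?G) \<times> off_diagonal n. ?\<Phi> x = b} = n * (n - 1)" .
qed

lemma ranked_forest_stationary:
  assumes n: "n \<ge> 2"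
  shows "moran_stationary n (ranked_forest n)"
  unfolding moran_stationary_def
proof (intro conjI)
  let ?S = "{\<rho>. \<rho> permutes {1..n}} \<times> parent_maps n"
  have S: "finite ?S" "?S \<noteq> {}"
  proof -
    show "finite ?S" by (simp add: finite_permutations finite_parent_maps)
    have "id \<in> {\<rho>. \<rho> permutes {1..n}}" by (simp add: permutes_id)
    then show "?S \<noteq> {}" using parent_maps_nonempty[OF n] by blast
  qed
  have "ranked_edges n \<rho> g \<in> digraphs {1..n}" if "g \<in> parent_maps n" for \<rho> g
    using that by (auto simp: ranked_edges_def digraphs_def mem_parent_maps_iff irrefl_def)
  then show "set_pmf (ranked_forest n) \<subseteq> digraphs {1..n}"
    using S by (auto simp: ranked_forest_def)
  have "bind_pmf (ranked_forest n) (moran_step n) =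
    map_pmf (\<lambda>((\<rho>, g), (u, v)). update_edges (u, v) (ranked_edges n \<rho> g))
      (pair_pmf (pmf_of_set ?S) (pmf_of_set (off_diagonal n)))"
    unfolding ranked_forest_def moran_step_def pair_pmf_def
    by (simp add: map_pmf_def bind_assoc_pmf bind_return_pmf case_prod_unfold)
  also have "pair_pmf (pmf_of_set ?S) (pmf_of_set (off_diagonal n)) = pmf_of_set (?S \<times> off_diagonal n)"
    using S by (intro pmf_of_set_times[symmetric] finite_off_diagonal off_diagonal_nonempty n)
  also have "map_pmf (\<lambda>((\<rho>, g), (u, v)). update_edges (u, v) (ranked_edges n \<rho> g)) \<dots>
    = map_pmf (\<lambda>x. case update_ranks_and_parents n x of (\<rho>, g) \<Rightarrow> ranked_edges n \<rho> g) \<dots>" (is "map_pmf ?f _ = map_pmf ?g _")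
  proof (rule map_pmf_cong[OF refl])
    fix x assume "x \<in> set_pmf (pmf_of_set (?S \<times> off_diagonal n))"
    then have "x \<in> ?S \<times> off_diagonal n"
      using S off_diagonal_nonempty[OF n] finite_off_diagonal by (subst (asm) set_pmf_of_set) auto
    then show "?f x = ?g x"
      using ranked_edges_update by (auto simp: update_ranks_and_parents_def)
  qed
  also have "\<dots> = map_pmf (\<lambda>(\<rho>, g). ranked_edges n \<rho> g)
      (map_pmf (update_ranks_and_parents n) (pmf_of_set (?S \<times> off_diagonal n)))"
    by (simp only: map_pmf_comp)
  also have "\<dots> = ranked_forest n"
    using update_preserves_uniform[OF n] by (simp add: ranked_forest_def)
  finally show "bind_pmf (ranked_forest n) (moran_step n) = ranked_forest n" .
qed

section \<open>Uniqueness of the stationary distribution\<close>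

lemma card_off_diagonal_avoiding:
  "card {x \<in> off_diagonal n. snd x \<noteq> a} = card ({1..n} - {a}) * (n - 1)"
proof -
  have "{x \<in> off_diagonal n. snd x \<noteq> a} = prod.swap ` (SIGMA v:{1..n} - {a}. {1..n} - {v})"
    by (auto simp: image_iff)
  then have "card {x \<in> off_diagonal n. snd x \<noteq> a} = card (SIGMA v:{1..n} - {a}. {1..n} - {v})"
    by (simp add: card_image)
  then show ?thesis by simp
qed

text \<open>The label \<open>0\<close> is not a vertex, so avoiding it is no restriction.\<close>
lemma card_off_diagonal: "card (off_diagonal n) = n * (n - 1)"
proof -
  have "{x \<in> off_diagonal n. snd x \<noteq> 0} = off_diagonal n" by auto
  then show ?thesis using card_off_diagonal_avoiding[of n 0] by simp
qed

definition lipschitz_on_digraphs :: "nat \<Rightarrow> real \<Rightarrow> (nat rel \<Rightarrow> real) \<Rightarrow> bool" where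
  "lipschitz_on_digraphs n L h \<longleftrightarrow>
    (\<forall>E\<in>digraphs {1..n}. \<forall>F\<in>digraphs {1..n}. \<bar>h E - h F\<bar> \<le> L * card (sym_diff E F))"

text \<open>Couple the steps from \<open>E\<close> and \<open>F\<close> by using the same pair \<open>(u, v)\<close>. The new edge is common to
  both results, and an edge in which \<open>E\<close> and \<open>F\<close> differ can only survive if \<open>v\<close> is not its
  starting point, which has probability \<open>(n - 1) / n\<close>. So the expected size of the symmetric
  difference shrinks by this factor.\<close>
lemma moran_step_contracts:
  assumes n: "n \<ge> 2" and L: "L \<ge> 0" and h: "lipschitz_on_digraphs n L h"
  shows "lipschitz_on_digraphs n (real (n - 1) / n * L)
    (\<lambda>E. measure_pmf.expectation (moran_step n E) h)"
  unfolding lipschitz_on_digraphs_def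
proof (intro ballI)
  fix E F assume E: "E \<in> digraphs {1..n}" and F: "F \<in> digraphs {1..n}"
  let ?O = "off_diagonal n"
  let ?D = "sym_diff E F"
  have D: "?D \<subseteq> {1..n} \<times> {1..n}" using E F by (auto simp: digraphs_def)
  then have finD: "finite ?D" by (rule finite_subset) simp
  have "(\<Sum>x\<in>?O. card {e \<in> ?D. snd x \<noteq> fst e}) = (n - 1) * (n - 1) * card ?D"
  proof (rule sum_multicount[OF finite_off_diagonal finD], intro ballI)
    fix e assume "e \<in> ?D"
    then have "fst e \<in> {1..n}" using D by (metis SigmaE fst_conv subsetD)
    then show "card {x \<in> ?O. snd x \<noteq> fst e} = (n - 1) * (n - 1)"
      unfolding card_off_diagonal_avoiding by simp
  qed
  moreover
  have "card (sym_diff (update_edges x E) (update_edges x F)) \<le> card {e \<in> ?D. snd x \<noteq> fst e}" for x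
  proof (rule card_mono)
    show "finite {e \<in> ?D. snd x \<noteq> fst e}"
      using finD by (rule rev_finite_subset) blast
    show "sym_diff (update_edges x E) (update_edges x F) \<subseteq> {e \<in> ?D. snd x \<noteq> fst e}"
      by (auto split: prod.splits)
  qed
  then have "(\<Sum>x\<in>?O. card (sym_diff (update_edges x E) (update_edges x F)))
      \<le> (\<Sum>x\<in>?O. card {e \<in> ?D. snd x \<noteq> fst e})"
    by (rule sum_mono)
  ultimately have "(\<Sum>x\<in>?O. card (sym_diff (update_edges x E) (update_edges x F))) \<le> (n - 1) * (n - 1) * card ?D"
    by (simp only:)
  then have card_sum: "(\<Sum>x\<in>?O. real (card (sym_diff (update_edges x E) (update_edges x F))))
      \<le> real (n - 1) * real (n - 1) * real (card ?D)"
    by (simp only: flip: of_nat_sum of_nat_mult)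
  have avg: "measure_pmf.expectation (moran_step n G) h = (\<Sum>x\<in>?O. h (update_edges x G)) / card ?O" for G
    unfolding moran_step_eq_map integral_map_pmf
    by (rule integral_pmf_of_set[OF off_diagonal_nonempty[OF n] finite_off_diagonal])
  have "\<bar>measure_pmf.expectation (moran_step n E) h - measure_pmf.expectation (moran_step n F) h\<bar>
      = \<bar>\<Sum>x\<in>?O. h (update_edges x E) - h (update_edges x F)\<bar> / card ?O"
    unfolding avg by (simp add: sum_subtractf flip: diff_divide_distrib)
  also have "\<dots> \<le> (\<Sum>x\<in>?O. \<bar>h (update_edges x E) - h (update_edges x F)\<bar>) / card ?O"
    by (intro divide_right_mono sum_abs) simp
  also have "\<dots> \<le> (\<Sum>x\<in>?O. L * card (sym_diff (update_edges x E) (update_edges x F))) / card ?O"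
  proof (intro divide_right_mono sum_mono)
    fix x assume "x \<in> ?O"
    then show "\<bar>h (update_edges x E) - h (update_edges x F)\<bar> \<le> L * card (sym_diff (update_edges x E) (update_edges x F))"
      using h update_edges_in_digraphs[OF E] update_edges_in_digraphs[OF F]
      unfolding lipschitz_on_digraphs_def by blast
  qed simp
  also have "\<dots> \<le> L * (real (n - 1) * real (n - 1) * real (card ?D)) / card ?O"
    unfolding sum_distrib_left[symmetric]
    by (intro divide_right_mono mult_left_mono card_sum L) simp
  also have "\<dots> = real (n - 1) / n * L * card ?D"
    unfolding card_off_diagonal using n by simp
  finally show "\<bar>measure_pmf.expectation (moran_step n E) h - measure_pmf.expectation (moran_step n F) h\<bar>
      \<le> real (n - 1) / n * L * card ?D" .
qed

lemma moran_stationary_expectation: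
  fixes h :: "nat rel \<Rightarrow> real"
  assumes n: "n \<ge> 2" and p: "moran_stationary n p"
  shows "measure_pmf.expectation p (\<lambda>E. measure_pmf.expectation (moran_step n E) h)
    = measure_pmf.expectation p h"
proof -
  have supp: "set_pmf p \<subseteq> digraphs {1..n}" and bind: "bind_pmf p (moran_step n) = p"
    using p by (auto simp: moran_stationary_def)
  have fin: "finite (set_pmf (moran_step n E))" for E
    using set_pmf_of_set[OF off_diagonal_nonempty[OF n] finite_off_diagonal] finite_off_diagonal
    by (simp add: moran_step_eq_map)
  have "measure_pmf.expectation (bind_pmf p (moran_step n)) h
      = (\<Sum>E\<in>digraphs {1..n}. pmf p E *\<^sub>R measure_pmf.expectation (moran_step n E) h)"
    using fin supp by (intro pmf_expectation_bind finite_digraphs) auto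
  also have "\<dots> = measure_pmf.expectation p (\<lambda>E. measure_pmf.expectation (moran_step n E) h)"
    using supp by (intro integral_measure_pmf[symmetric] finite_digraphs) auto
  finally show ?thesis using bind by simp
qed

text \<open>The empty digraph serves as a reference point: every digraph differs from it in at most
  \<open>n * n\<close> edges.\<close>
lemma expectation_near_empty:
  assumes supp: "set_pmf p \<subseteq> digraphs {1..n}" and L: "L \<ge> 0" and h: "lipschitz_on_digraphs n L h"
  shows "\<bar>measure_pmf.expectation p h - h {}\<bar> \<le> L * (n * n)"
proof -
  let ?D = "digraphs {1..n}"
  have one: "(\<Sum>E\<in>?D. pmf p E) = 1"
    using supp by (intro sum_pmf_eq_1 finite_digraphs) auto
  have bound: "\<bar>h E - h {}\<bar> \<le> L * (n * n)" if E: "E \<in> ?D" for E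
  proof -
    have "{} \<in> ?D" by (simp add: digraphs_def irrefl_def)
    then have "\<bar>h E - h {}\<bar> \<le> L * card (sym_diff E {})"
      using h E unfolding lipschitz_on_digraphs_def by blast
    also have "card (sym_diff E {}) \<le> n * n"
      using E card_mono[of "{1..n} \<times> {1..n}" E] by (simp add: digraphs_def)
    then have "L * card (sym_diff E {}) \<le> L * (n * n)"
      using L by (intro mult_left_mono) (simp_all flip: of_nat_mult)
    finally show ?thesis .
  qed
  have "measure_pmf.expectation p h = (\<Sum>E\<in>?D. pmf p E * h E)"
    using supp by (subst integral_measure_pmf[of ?D]) (auto simp: finite_digraphs)
  then have "measure_pmf.expectation p h - h {} = (\<Sum>E\<in>?D. pmf p E * (h E - h {}))"
    using one by (simp add: right_diff_distrib sum_subtractf flip: sum_distrib_right)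
  then have "\<bar>measure_pmf.expectation p h - h {}\<bar> \<le> (\<Sum>E\<in>?D. pmf p E * \<bar>h E - h {}\<bar>)"
    using sum_abs[of "\<lambda>E. pmf p E * (h E - h {})" ?D] by (simp add: abs_mult)
  also have "\<dots> \<le> (\<Sum>E\<in>?D. pmf p E * (L * (n * n)))"
    by (intro sum_mono mult_left_mono bound) simp_all
  also have "\<dots> = L * (n * n)"
    using one by (simp flip: sum_distrib_right)
  finally show ?thesis .
qed

text \<open>A stationary law does not notice if a function is replaced by its average after one step, and
  each such replacement multiplies the Lipschitz constant by \<open>(n - 1) / n\<close>. After many replacements
  the function is almost constant, so that its expectation hardly depends on the law. Applied to
  the indicator of a single digraph, which is Lipschitz because different digraphs differ in at
  least one edge, this shows that two stationary laws give it the same probability.\<close>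
theorem moran_stationary_unique:
  assumes n: "n \<ge> 2" and p: "moran_stationary n p" and q: "moran_stationary n q"
  shows "p = q"
proof (rule pmf_eqI)
  fix E0
  define c where "c = real (n - 1) / n"
  have c: "0 \<le> c" "c < 1" using n by (auto simp: c_def)
  \<comment> \<open>The exponent \<open>k\<close> counts the replacements of \<open>h\<close> by its average; both expectations of the last
    function are within \<open>c ^ k * L * (n * n)\<close> of its value at the empty digraph, hence the factor \<open>2\<close>.\<close>
  have close: "\<bar>measure_pmf.expectation p h - measure_pmf.expectation q h\<bar> \<le> c ^ k * (2 * L * (n * n))"
    if "L \<ge> 0" "lipschitz_on_digraphs n L h" for k L h
    using that
  proof (induction k arbitrary: L h)
    case 0
    have "set_pmf p \<subseteq> digraphs {1..n}" "set_pmf q \<subseteq> digraphs {1..n}"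
      using p q by (simp_all add: moran_stationary_def)
    from this[THEN expectation_near_empty, OF 0] show ?case by simp
  next
    case (Suc k)
    have "lipschitz_on_digraphs n (c * L) (\<lambda>E. measure_pmf.expectation (moran_step n E) h)"
      unfolding c_def by (rule moran_step_contracts[OF n Suc.prems])
    from Suc.IH[OF _ this] show ?case
      using c Suc.prems(1)
      by (simp add: moran_stationary_expectation[OF n p] moran_stationary_expectation[OF n q] mult_ac)
  qed
  have "lipschitz_on_digraphs n 1 (indicator {E0})"
    unfolding lipschitz_on_digraphs_def
  proof (intro ballI)
    fix E F assume EF: "E \<in> digraphs {1..n}" "F \<in> digraphs {1..n}"
    have "card (sym_diff E F) \<ge> 1" if "E \<noteq> F"
    proof -
      have "sym_diff E F \<subseteq> {1..n} \<times> {1..n}" using EF by (auto simp: digraphs_def)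
      then have "finite (sym_diff E F)" by (rule finite_subset) simp
      moreover have "sym_diff E F \<noteq> {}" using that by blast
      ultimately show ?thesis by (metis One_nat_def Suc_leI card_gt_0_iff)
    qed
    then show "\<bar>indicator {E0} E - indicator {E0} F\<bar> \<le> 1 * real (card (sym_diff E F))"
      by (cases "E = F") (auto simp: indicator_def)
  qed
  from close[OF _ this] have bound: "\<bar>pmf p E0 - pmf q E0\<bar> \<le> c ^ k * (2 * (n * n))" for k
    by (simp add: measure_pmf_single)
  have "(\<lambda>k. c ^ k * (2 * (n * n))) \<longlonglongrightarrow> 0 * real (2 * (n * n))"
    using c by (intro tendsto_mult_right LIMSEQ_power_zero) simp
  then have "\<bar>pmf p E0 - pmf q E0\<bar> \<le> 0 * real (2 * (n * n))"
    using bound by (intro LIMSEQ_le_const) auto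
  then show "pmf p E0 = pmf q E0" by simp
qed

theorem theorem1p1:
  fixes n :: nat
  assumes "n \<ge> 2"
  shows "tree_construction n = moran_forest n"
proof -
  have "moran_forest n = ranked_forest n"
    unfolding moran_forest_def
    using ranked_forest_stationary[OF assms] moran_stationary_unique[OF assms]
    by (intro the_equality) auto
  then show ?thesis
    using tree_construction_eq_ranked_forest[OF assms] by simp
qed

end
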